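(* Let $\mathbb{C}$ be a pointed category with binary products and coequalisers in which binary products commute with coequalisers, and suppose that $\mathbb{C}$ satisfies the condition $\mathsf{(T)}$: for every object $X$ and all morphisms $\phi\colon X\times X\to Y$ and $f\colon X\to Y$ with $\phi\circ(1_X,0)=f=\phi\circ(0,1_X)$, if $\phi$ is a regular epimorphism then so is $f$. Then the full subcategory $\mathsf{Com}(\mathbb{C})$ of commutative objects is a Birkhoff subcategory of $\mathbb{C}$, i.e. it is a reflective subcategory of $\mathbb{C}$ which is closed under products, subobjects and regular quotients. Moreover the reflection $r\colon\mathbb{C}\to\mathsf{Com}(\mathbb{C})$ preserves binary products, and the inclusion $\iota\colon\mathsf{Com}(\mathbb{C})\to\mathbb{C}$ preserves coequalisers.
   Context: A pointed category is a category with a zero object $0$; zero morphisms are also denoted $0$. Binary products commute with coequalisers in $\mathbb{C}$ if for any two coequaliser diagrams $C_1\rightrightarrows X_1\xrightarrow{q_1}Q_1$ (of $u_1,v_1$) and $C_2\rightrightarrows X_2\xrightarrow{q_2}Q_2$ (of $u_2,v_2$), the morphism $q_1\times q_2$ is a coequaliser of $u_1\times u_2$ and $v_1\times v_2$. An object $X$ of $\mathbb{C}$ is commutative if there is a morphism $\rho_X\colon X\times X\to X$ with $\rho_X\circ(1_X,0)=1_X=\rho_X\circ(0,1_X)$. Closed under subobjects: if $A\to X$ is a monomorphism in $\mathbb{C}$ and $X$ is commutative, then $A$ is commutative. Closed under regular quotients: if $X\to Y$ is a regular epimorphism in $\mathbb{C}$ and $X$ is commutative, then $Y$ is commutative. 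*)

theory Defs
  imports Main
begin

section \<open>Categories\<close>

record ('o, 'm) cat =
  Obj :: "'o set"
  Arr :: "'m set"
  Dom :: "'m \<Rightarrow> 'o"
  Cod :: "'m \<Rightarrow> 'o"
  Comp :: "'m \<Rightarrow> 'm \<Rightarrow> 'm"  (infixr \<open>\<cdot>\<index>\<close> 55)
  Ide :: "'o \<Rightarrow> 'm"

text \<open>\<open>g \<cdot>\<^bsub>C\<^esub> f\<close> is ``g after f''; it is only constrained when the codomain of \<open>f\<close> is the
  domain of \<open>g\<close>.\<close>

definition hom :: "('o, 'm) cat \<Rightarrow> 'o \<Rightarrow> 'o \<Rightarrow> 'm set" where
  "hom C X Y = {f \<in> Arr C. Dom C f = X \<and> Cod C f = Y}"

definition category :: "('o, 'm) cat \<Rightarrow> bool" where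
  "category C \<longleftrightarrow>
     (\<forall>f \<in> Arr C. Dom C f \<in> Obj C \<and> Cod C f \<in> Obj C) \<and>
     (\<forall>X \<in> Obj C. Ide C X \<in> hom C X X) \<and>
     (\<forall>X Y Z. \<forall>f \<in> hom C X Y. \<forall>g \<in> hom C Y Z. g \<cdot>\<^bsub>C\<^esub> f \<in> hom C X Z) \<and>
     (\<forall>X Y. \<forall>f \<in> hom C X Y. f \<cdot>\<^bsub>C\<^esub> Ide C X = f \<and> Ide C Y \<cdot>\<^bsub>C\<^esub> f = f) \<and>
     (\<forall>W X Y Z. \<forall>f \<in> hom C W X. \<forall>g \<in> hom C X Y. \<forall>h \<in> hom C Y Z.
        h \<cdot>\<^bsub>C\<^esub> (g \<cdot>\<^bsub>C\<^esub> f) = (h \<cdot>\<^bsub>C\<^esub> g) \<cdot>\<^bsub>C\<^esub> f)"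

definition monomorphism :: "('o, 'm) cat \<Rightarrow> 'm \<Rightarrow> bool" where
  "monomorphism C m \<longleftrightarrow> m \<in> Arr C \<and>
     (\<forall>W. \<forall>f \<in> hom C W (Dom C m). \<forall>g \<in> hom C W (Dom C m).
        m \<cdot>\<^bsub>C\<^esub> f = m \<cdot>\<^bsub>C\<^esub> g \<longrightarrow> f = g)"


section \<open>Zero objects and zero morphisms\<close>

definition zero_object :: "('o, 'm) cat \<Rightarrow> 'o \<Rightarrow> bool" where
  "zero_object C Z \<longleftrightarrow> Z \<in> Obj C \<and>
     (\<forall>X \<in> Obj C. (\<exists>!f. f \<in> hom C X Z) \<and> (\<exists>!f. f \<in> hom C Z X))"

definition pointed :: "('o, 'm) cat \<Rightarrow> bool" where
  "pointed C \<longleftrightarrow> (\<exists>Z. zero_object C Z)"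

text \<open>The morphism that factors through a zero object; it does not depend on which one.\<close>

definition zero_mor :: "('o, 'm) cat \<Rightarrow> 'o \<Rightarrow> 'o \<Rightarrow> 'm" where
  "zero_mor C X Y =
     (THE f. \<exists>Z g h. zero_object C Z \<and> g \<in> hom C X Z \<and> h \<in> hom C Z Y \<and> f = h \<cdot>\<^bsub>C\<^esub> g)"


section \<open>Products\<close>

definition is_binary_product ::
    "('o, 'm) cat \<Rightarrow> 'o \<Rightarrow> 'o \<Rightarrow> 'o \<Rightarrow> 'm \<Rightarrow> 'm \<Rightarrow> bool" where
  "is_binary_product C X Y P p q \<longleftrightarrow>
     X \<in> Obj C \<and> Y \<in> Obj C \<and> P \<in> Obj C \<and> p \<in> hom C P X \<and> q \<in> hom C P Y \<and>
     (\<forall>W \<in> Obj C. \<forall>f \<in> hom C W X. \<forall>g \<in> hom C W Y.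
        \<exists>!h. h \<in> hom C W P \<and> p \<cdot>\<^bsub>C\<^esub> h = f \<and> q \<cdot>\<^bsub>C\<^esub> h = g)"

definition has_binary_products :: "('o, 'm) cat \<Rightarrow> bool" where
  "has_binary_products C \<longleftrightarrow>
     (\<forall>X \<in> Obj C. \<forall>Y \<in> Obj C. \<exists>P p q. is_binary_product C X Y P p q)"

definition is_product ::
    "('o, 'm) cat \<Rightarrow> 'i set \<Rightarrow> ('i \<Rightarrow> 'o) \<Rightarrow> 'o \<Rightarrow> ('i \<Rightarrow> 'm) \<Rightarrow> bool" where
  "is_product C I X P p \<longleftrightarrow>
     P \<in> Obj C \<and> (\<forall>i \<in> I. X i \<in> Obj C \<and> p i \<in> hom C P (X i)) \<and>
     (\<forall>W \<in> Obj C. \<forall>f. (\<forall>i \<in> I. f i \<in> hom C W (X i)) \<longrightarrow>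
        (\<exists>!h. h \<in> hom C W P \<and> (\<forall>i \<in> I. p i \<cdot>\<^bsub>C\<^esub> h = f i)))"

text \<open>A fixed but arbitrary choice of a binary product diagram for each pair of objects; meaningful
  in categories with binary products.\<close>

definition chosen_product :: "('o, 'm) cat \<Rightarrow> 'o \<Rightarrow> 'o \<Rightarrow> 'o \<times> 'm \<times> 'm" where
  "chosen_product C X Y = (SOME (P, p, q). is_binary_product C X Y P p q)"

definition prod_obj :: "('o, 'm) cat \<Rightarrow> 'o \<Rightarrow> 'o \<Rightarrow> 'o" where
  "prod_obj C X Y = fst (chosen_product C X Y)"

definition proj1 :: "('o, 'm) cat \<Rightarrow> 'o \<Rightarrow> 'o \<Rightarrow> 'm" where
  "proj1 C X Y = fst (snd (chosen_product C X Y))"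

definition proj2 :: "('o, 'm) cat \<Rightarrow> 'o \<Rightarrow> 'o \<Rightarrow> 'm" where
  "proj2 C X Y = snd (snd (chosen_product C X Y))"

definition pairing :: "('o, 'm) cat \<Rightarrow> 'm \<Rightarrow> 'm \<Rightarrow> 'm" where
  "pairing C f g =
     (THE h. h \<in> hom C (Dom C f) (prod_obj C (Cod C f) (Cod C g)) \<and>
             proj1 C (Cod C f) (Cod C g) \<cdot>\<^bsub>C\<^esub> h = f \<and> proj2 C (Cod C f) (Cod C g) \<cdot>\<^bsub>C\<^esub> h = g)"

definition prod_mor :: "('o, 'm) cat \<Rightarrow> 'm \<Rightarrow> 'm \<Rightarrow> 'm" where
  "prod_mor C f g =
     pairing C (f \<cdot>\<^bsub>C\<^esub> proj1 C (Dom C f) (Dom C g)) (g \<cdot>\<^bsub>C\<^esub> proj2 C (Dom C f) (Dom C g))"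


section \<open>Coequalisers\<close>

definition is_coequaliser :: "('o, 'm) cat \<Rightarrow> 'm \<Rightarrow> 'm \<Rightarrow> 'm \<Rightarrow> bool" where
  "is_coequaliser C u v q \<longleftrightarrow>
     u \<in> Arr C \<and> v \<in> Arr C \<and> q \<in> Arr C \<and>
     Dom C u = Dom C v \<and> Cod C u = Cod C v \<and> Dom C q = Cod C u \<and>
     q \<cdot>\<^bsub>C\<^esub> u = q \<cdot>\<^bsub>C\<^esub> v \<and>
     (\<forall>Z. \<forall>f \<in> hom C (Dom C q) Z. f \<cdot>\<^bsub>C\<^esub> u = f \<cdot>\<^bsub>C\<^esub> v \<longrightarrow>
        (\<exists>!g. g \<in> hom C (Cod C q) Z \<and> g \<cdot>\<^bsub>C\<^esub> q = f))"

definition has_coequalisers :: "('o, 'm) cat \<Rightarrow> bool" where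
  "has_coequalisers C \<longleftrightarrow>
     (\<forall>X Y. \<forall>u \<in> hom C X Y. \<forall>v \<in> hom C X Y. \<exists>q. is_coequaliser C u v q)"

definition regular_epi :: "('o, 'm) cat \<Rightarrow> 'm \<Rightarrow> bool" where
  "regular_epi C q \<longleftrightarrow> (\<exists>u v. is_coequaliser C u v q)"

definition products_commute_with_coequalisers :: "('o, 'm) cat \<Rightarrow> bool" where
  "products_commute_with_coequalisers C \<longleftrightarrow>
     (\<forall>u1 v1 q1 u2 v2 q2. is_coequaliser C u1 v1 q1 \<and> is_coequaliser C u2 v2 q2 \<longrightarrow>
        is_coequaliser C (prod_mor C u1 u2) (prod_mor C v1 v2) (prod_mor C q1 q2))"


section \<open>Functors, adjunctions and subcategories\<close>

record ('o1, 'm1, 'o2, 'm2) fun_data =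
  on_obj :: "'o1 \<Rightarrow> 'o2"
  on_arr :: "'m1 \<Rightarrow> 'm2"

definition is_functor ::
    "('o1, 'm1) cat \<Rightarrow> ('o2, 'm2) cat \<Rightarrow> ('o1, 'm1, 'o2, 'm2) fun_data \<Rightarrow> bool" where
  "is_functor C D F \<longleftrightarrow>
     (\<forall>X \<in> Obj C. on_obj F X \<in> Obj D) \<and>
     (\<forall>X Y. \<forall>f \<in> hom C X Y. on_arr F f \<in> hom D (on_obj F X) (on_obj F Y)) \<and>
     (\<forall>X \<in> Obj C. on_arr F (Ide C X) = Ide D (on_obj F X)) \<and>
     (\<forall>X Y Z. \<forall>f \<in> hom C X Y. \<forall>g \<in> hom C Y Z.
        on_arr F (g \<cdot>\<^bsub>C\<^esub> f) = on_arr F g \<cdot>\<^bsub>D\<^esub> on_arr F f)"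

text \<open>\<open>F : C \<rightarrow> D\<close> is left adjoint to \<open>G : D \<rightarrow> C\<close> with unit \<open>\<eta>\<close>.\<close>

definition is_left_adjoint ::
    "('o1, 'm1) cat \<Rightarrow> ('o2, 'm2) cat \<Rightarrow> ('o1, 'm1, 'o2, 'm2) fun_data \<Rightarrow>
     ('o2, 'm2, 'o1, 'm1) fun_data \<Rightarrow> ('o1 \<Rightarrow> 'm1) \<Rightarrow> bool" where
  "is_left_adjoint C D F G \<eta> \<longleftrightarrow>
     is_functor C D F \<and> is_functor D C G \<and>
     (\<forall>X \<in> Obj C. \<eta> X \<in> hom C X (on_obj G (on_obj F X))) \<and>
     (\<forall>X Y. \<forall>f \<in> hom C X Y. on_arr G (on_arr F f) \<cdot>\<^bsub>C\<^esub> \<eta> X = \<eta> Y \<cdot>\<^bsub>C\<^esub> f) \<and>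
     (\<forall>X \<in> Obj C. \<forall>Y \<in> Obj D. \<forall>f \<in> hom C X (on_obj G Y).
        \<exists>!g. g \<in> hom D (on_obj F X) Y \<and> on_arr G g \<cdot>\<^bsub>C\<^esub> \<eta> X = f)"

definition preserves_binary_products ::
    "('o1, 'm1) cat \<Rightarrow> ('o2, 'm2) cat \<Rightarrow> ('o1, 'm1, 'o2, 'm2) fun_data \<Rightarrow> bool" where
  "preserves_binary_products C D F \<longleftrightarrow>
     (\<forall>X Y P p q. is_binary_product C X Y P p q \<longrightarrow>
        is_binary_product D (on_obj F X) (on_obj F Y) (on_obj F P) (on_arr F p) (on_arr F q))"

definition preserves_coequalisers ::
    "('o1, 'm1) cat \<Rightarrow> ('o2, 'm2) cat \<Rightarrow> ('o1, 'm1, 'o2, 'm2) fun_data \<Rightarrow> bool" where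
  "preserves_coequalisers C D F \<longleftrightarrow>
     (\<forall>u v q. is_coequaliser C u v q \<longrightarrow>
        is_coequaliser D (on_arr F u) (on_arr F v) (on_arr F q))"

definition full_subcat :: "('o, 'm) cat \<Rightarrow> 'o set \<Rightarrow> ('o, 'm) cat" where
  "full_subcat C S = C\<lparr>Obj := Obj C \<inter> S, Arr := {f \<in> Arr C. Dom C f \<in> S \<and> Cod C f \<in> S}\<rparr>"

definition is_full_subcategory :: "('o, 'm) cat \<Rightarrow> ('o, 'm) cat \<Rightarrow> bool" where
  "is_full_subcategory D C \<longleftrightarrow> (\<exists>S. D = full_subcat C S)"

definition inclusion :: "('o, 'm, 'o, 'm) fun_data" where
  "inclusion = \<lparr>on_obj = (\<lambda>X. X), on_arr = (\<lambda>f. f)\<rparr>"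

definition is_reflection ::
    "('o, 'm) cat \<Rightarrow> ('o, 'm) cat \<Rightarrow> ('o, 'm, 'o, 'm) fun_data \<Rightarrow> ('o \<Rightarrow> 'm) \<Rightarrow> bool" where
  "is_reflection C D r \<eta> \<longleftrightarrow> is_left_adjoint C D r inclusion \<eta>"

definition reflective :: "('o, 'm) cat \<Rightarrow> ('o, 'm) cat \<Rightarrow> bool" where
  "reflective C D \<longleftrightarrow> (\<exists>r \<eta>. is_reflection C D r \<eta>)"

definition closed_under_binary_products :: "('o, 'm) cat \<Rightarrow> ('o, 'm) cat \<Rightarrow> bool" where
  "closed_under_binary_products C D \<longleftrightarrow>
     (\<forall>X \<in> Obj D. \<forall>Y \<in> Obj D. \<forall>P p q. is_binary_product C X Y P p q \<longrightarrow> P \<in> Obj D)"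

text \<open>Closure under all products, indexed by sets of elements of the type \<open>'i\<close>, that exist in \<open>C\<close>.\<close>

definition closed_under_products :: "'i itself \<Rightarrow> ('o, 'm) cat \<Rightarrow> ('o, 'm) cat \<Rightarrow> bool" where
  "closed_under_products _ C D \<longleftrightarrow>
     (\<forall>(I :: 'i set) X P p. (\<forall>i \<in> I. X i \<in> Obj D) \<and> is_product C I X P p \<longrightarrow> P \<in> Obj D)"

definition closed_under_subobjects :: "('o, 'm) cat \<Rightarrow> ('o, 'm) cat \<Rightarrow> bool" where
  "closed_under_subobjects C D \<longleftrightarrow>
     (\<forall>m. monomorphism C m \<and> Cod C m \<in> Obj D \<longrightarrow> Dom C m \<in> Obj D)"

definition closed_under_regular_quotients :: "('o, 'm) cat \<Rightarrow> ('o, 'm) cat \<Rightarrow> bool" where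
  "closed_under_regular_quotients C D \<longleftrightarrow>
     (\<forall>q. regular_epi C q \<and> Dom C q \<in> Obj D \<longrightarrow> Cod C q \<in> Obj D)"

text \<open>The type argument only fixes the type of the indices of the products in the closure condition;
  theorems are meant to be polymorphic in it.  Binary products are listed separately so that their
  case does not depend on the instance of \<open>'i\<close>.\<close>

definition birkhoff_subcategory :: "'i itself \<Rightarrow> ('o, 'm) cat \<Rightarrow> ('o, 'm) cat \<Rightarrow> bool" where
  "birkhoff_subcategory T C D \<longleftrightarrow>
     is_full_subcategory D C \<and> reflective C D \<and>
     closed_under_binary_products C D \<and> closed_under_products T C D \<and>
     closed_under_subobjects C D \<and> closed_under_regular_quotients C D"


section \<open>Commutative objects and condition (T)\<close>

definition inj1 :: "('o, 'm) cat \<Rightarrow> 'o \<Rightarrow> 'm" where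
  "inj1 C X = pairing C (Ide C X) (zero_mor C X X)"

definition inj2 :: "('o, 'm) cat \<Rightarrow> 'o \<Rightarrow> 'm" where
  "inj2 C X = pairing C (zero_mor C X X) (Ide C X)"

definition commutative_object :: "('o, 'm) cat \<Rightarrow> 'o \<Rightarrow> bool" where
  "commutative_object C X \<longleftrightarrow> X \<in> Obj C \<and>
     (\<exists>\<rho> \<in> hom C (prod_obj C X X) X.
        \<rho> \<cdot>\<^bsub>C\<^esub> inj1 C X = Ide C X \<and> \<rho> \<cdot>\<^bsub>C\<^esub> inj2 C X = Ide C X)"

definition Com :: "('o, 'm) cat \<Rightarrow> ('o, 'm) cat" where
  "Com C = full_subcat C {X. commutative_object C X}"

definition condition_T :: "('o, 'm) cat \<Rightarrow> bool" where
  "condition_T C \<longleftrightarrow>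
     (\<forall>X \<in> Obj C. \<forall>Y \<in> Obj C. \<forall>\<phi> \<in> hom C (prod_obj C X X) Y. \<forall>f \<in> hom C X Y.
        \<phi> \<cdot>\<^bsub>C\<^esub> inj1 C X = f \<and> \<phi> \<cdot>\<^bsub>C\<^esub> inj2 C X = f \<and> regular_epi C \<phi> \<longrightarrow> regular_epi C f)"

end

theory Submission
  imports Defs
begin

text \<open>
  The main tool is one consequence of the commutation of products with coequalisers. The identity
  of \<open>X\<close> is a coequaliser of the zero endomorphism with itself; hence, if \<open>e : Y \<rightarrow> Y'\<close> is a
  coequaliser of \<open>s\<close> and \<open>t\<close>, then \<open>1 \<times> e\<close> is a coequaliser of \<open>0 \<times> s\<close> and \<open>0 \<times> t\<close>. These two
  morphisms factor through the axis \<open>(0, 1) : Y \<rightarrow> X \<times> Y\<close>, so that a morphism \<open>\<phi>\<close> on \<open>X \<times> Y\<close>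
  descends along \<open>1 \<times> e\<close> as soon as its restriction to that axis descends along \<open>e\<close>. Doing this in
  both variables (lemma \<open>factor_through_product\<close>): for regular epimorphisms \<open>e\<close> and \<open>e'\<close>, a morphism
  descends along \<open>e \<times> e'\<close> as soon as its restrictions to the two axes descend along \<open>e\<close> and \<open>e'\<close>.

  The reflection of \<open>X\<close> is obtained from the coequaliser \<open>q : X \<times> X \<rightarrow> Q\<close> of the two injections
  \<open>(1, 0)\<close> and \<open>(0, 1)\<close>: its unit \<open>\<eta>\<close> is the common composite of \<open>q\<close> with the injections, and it is
  a regular epimorphism by condition (T). A morphism \<open>f\<close> into a commutative object \<open>(Y, \<rho>)\<close> factors
  through \<open>\<eta>\<close> because \<open>\<rho> (f \<times> f)\<close> has both restrictions equal to \<open>f\<close>. The object \<open>Q\<close> is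
  commutative because both restrictions of \<open>q\<close> are \<open>\<eta>\<close>, so that \<open>q\<close> descends along \<open>\<eta> \<times> \<eta>\<close> to a
  multiplication on \<open>Q\<close>.

  The other claims, except closure under products, where multiplications are formed componentwise,
  follow from the same principle. If \<open>e\<close> is a regular epimorphism from a commutative object then \<open>e \<rho>\<close> descends along \<open>e \<times> e\<close>. If \<open>m\<close> is a monomorphism into a commutative
  object then \<open>m\<close> factors through the unit \<open>\<eta>\<close> of its domain, so \<open>\<eta>\<close> is a monomorphism as well as a
  regular epimorphism, i.e. an isomorphism. A morphism from \<open>X \<times> Y\<close> to a commutative object
  restricts to morphisms that descend along \<open>\<eta>\<^sub>X\<close> and \<open>\<eta>\<^sub>Y\<close>, whence it descends along
  \<open>\<eta>\<^sub>X \<times> \<eta>\<^sub>Y\<close>, which is therefore a reflection of \<open>X \<times> Y\<close>. Coequalisers are preserved by the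
  inclusion because of the closure under regular quotients.
\<close>

section \<open>Pointed categories with binary products\<close>

locale pointed_category_with_products =
  fixes C :: "('o, 'm) cat" (structure)
  assumes cat: "category C"
    and ptd: "pointed C"
    and prods: "has_binary_products C"
begin

abbreviation prd :: "'o \<Rightarrow> 'o \<Rightarrow> 'o" (infixr \<open>\<otimes>\<close> 70) where
  "X \<otimes> Y \<equiv> prod_obj C X Y"

lemma hom_obj:
  assumes "f \<in> hom C X Y"
  shows "X \<in> Obj C" "Y \<in> Obj C"
  using assms cat unfolding category_def hom_def by blast+

lemma hom_dom_cod:
  assumes "f \<in> hom C X Y"
  shows "f \<in> Arr C" "Dom C f = X" "Cod C f = Y"
  using assms unfolding hom_def by auto

lemma arr_hom: "f \<in> Arr C \<Longrightarrow> f \<in> hom C (Dom C f) (Cod C f)"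
  unfolding hom_def by auto

lemma comp_hom: "\<lbrakk>f \<in> hom C X Y; g \<in> hom C Y Z\<rbrakk> \<Longrightarrow> g \<cdot> f \<in> hom C X Z"
  using cat unfolding category_def by blast

lemma ide_hom: "X \<in> Obj C \<Longrightarrow> Ide C X \<in> hom C X X"
  using cat unfolding category_def by blast

lemma comp_ide: "f \<in> hom C X Y \<Longrightarrow> f \<cdot> Ide C X = f"
  using cat unfolding category_def by blast

lemma ide_comp: "f \<in> hom C X Y \<Longrightarrow> Ide C Y \<cdot> f = f"
  using cat unfolding category_def by blast

lemma assoc:
  "\<lbrakk>f \<in> hom C W X; g \<in> hom C X Y; h \<in> hom C Y Z\<rbrakk> \<Longrightarrow> h \<cdot> g \<cdot> f = (h \<cdot> g) \<cdot> f"
  using cat unfolding category_def by blast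

subsection \<open>Zero morphisms\<close>

lemma zero_object_hom_unique:
  assumes "zero_object C Z"
  shows "\<lbrakk>f \<in> hom C X Z; g \<in> hom C X Z\<rbrakk> \<Longrightarrow> f = g"
    and "\<lbrakk>f \<in> hom C Z X; g \<in> hom C Z X\<rbrakk> \<Longrightarrow> f = g"
proof -
  have *: "(\<exists>!f. f \<in> hom C X Z) \<and> (\<exists>!f. f \<in> hom C Z X)" if "X \<in> Obj C"
    using assms that unfolding zero_object_def by simp
  show "f = g" if "f \<in> hom C X Z" "g \<in> hom C X Z"
    using that * hom_obj(1)[OF that(1)] by auto
  show "f = g" if "f \<in> hom C Z X" "g \<in> hom C Z X"
    using that * hom_obj(2)[OF that(1)] by auto
qed

lemma zero_factorisation_unique:
  assumes "zero_object C Z" "g \<in> hom C X Z" "h \<in> hom C Z Y"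
    and "zero_object C Z'" "g' \<in> hom C X Z'" "h' \<in> hom C Z' Y"
  shows "h \<cdot> g = h' \<cdot> g'"
proof -
  obtain k where k: "k \<in> hom C Z Z'"
    using assms(4) hom_obj(1)[OF assms(3)] unfolding zero_object_def by auto
  have "k \<cdot> g = g'"
    by (rule zero_object_hom_unique(1)[OF assms(4) comp_hom[OF assms(2) k] assms(5)])
  moreover have "h' \<cdot> k = h"
    by (rule zero_object_hom_unique(2)[OF assms(1) comp_hom[OF k assms(6)] assms(3)])
  ultimately show ?thesis
    using assoc[OF assms(2) k assms(6)] by simp
qed

lemma zero_mor_eq:
  assumes "zero_object C Z" "g \<in> hom C X Z" "h \<in> hom C Z Y"
  shows "zero_mor C X Y = h \<cdot> g"
  unfolding zero_mor_def
  by (rule the_equality) (use assms zero_factorisation_unique in blast)+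

lemma zero_mor_factors:
  assumes "X \<in> Obj C" "Y \<in> Obj C"
  obtains Z g h where "zero_object C Z" "g \<in> hom C X Z" "h \<in> hom C Z Y" "zero_mor C X Y = h \<cdot> g"
proof -
  obtain Z where Z: "zero_object C Z"
    using ptd unfolding pointed_def by blast
  obtain g where g: "g \<in> hom C X Z"
    using Z assms(1) unfolding zero_object_def by blast
  obtain h where h: "h \<in> hom C Z Y"
    using Z assms(2) unfolding zero_object_def by blast
  show thesis
    using that[OF Z g h zero_mor_eq[OF Z g h]] .
qed

lemma zero_hom:
  assumes "X \<in> Obj C" "Y \<in> Obj C"
  shows "zero_mor C X Y \<in> hom C X Y"
  by (rule zero_mor_factors[OF assms]) (simp add: comp_hom)

lemma comp_zero:
  assumes "X \<in> Obj C" "f \<in> hom C Y Y'"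
  shows "f \<cdot> zero_mor C X Y = zero_mor C X Y'"
proof (rule zero_mor_factors[OF assms(1) hom_obj(1)[OF assms(2)]])
  fix Z g h assume *: "zero_object C Z" "g \<in> hom C X Z" "h \<in> hom C Z Y" "zero_mor C X Y = h \<cdot> g"
  show ?thesis
    using zero_mor_eq[OF *(1,2) comp_hom[OF *(3) assms(2)]] assoc[OF *(2,3) assms(2)] *(4) by simp
qed

lemma zero_comp:
  assumes "Y \<in> Obj C" "f \<in> hom C X' X"
  shows "zero_mor C X Y \<cdot> f = zero_mor C X' Y"
proof (rule zero_mor_factors[OF hom_obj(2)[OF assms(2)] assms(1)])
  fix Z g h assume *: "zero_object C Z" "g \<in> hom C X Z" "h \<in> hom C Z Y" "zero_mor C X Y = h \<cdot> g"
  show ?thesis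
    using zero_mor_eq[OF *(1) comp_hom[OF assms(2) *(2)] *(3)] assoc[OF assms(2) *(2,3)] *(4) by simp
qed

subsection \<open>The chosen binary products\<close>

lemma chosen_is_product:
  assumes "X \<in> Obj C" "Y \<in> Obj C"
  shows "is_binary_product C X Y (X \<otimes> Y) (proj1 C X Y) (proj2 C X Y)"
proof -
  have "\<exists>x. (\<lambda>(P, p, q). is_binary_product C X Y P p q) x"
    using prods assms unfolding has_binary_products_def by auto
  from someI_ex[OF this] show ?thesis
    unfolding prod_obj_def proj1_def proj2_def chosen_product_def by (auto split: prod.splits)
qed

lemma proj_hom:
  assumes "X \<in> Obj C" "Y \<in> Obj C"
  shows "proj1 C X Y \<in> hom C (X \<otimes> Y) X" "proj2 C X Y \<in> hom C (X \<otimes> Y) Y"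
  using chosen_is_product[OF assms] unfolding is_binary_product_def by auto

lemma prd_obj: "\<lbrakk>X \<in> Obj C; Y \<in> Obj C\<rbrakk> \<Longrightarrow> X \<otimes> Y \<in> Obj C"
  using proj_hom hom_obj by blast

lemma pairing_props:
  assumes "f \<in> hom C W X" "g \<in> hom C W Y"
  shows pairing_hom: "pairing C f g \<in> hom C W (X \<otimes> Y)"
    and proj1_pairing: "proj1 C X Y \<cdot> pairing C f g = f"
    and proj2_pairing: "proj2 C X Y \<cdot> pairing C f g = g"
proof -
  have "\<exists>!h. h \<in> hom C W (X \<otimes> Y) \<and> proj1 C X Y \<cdot> h = f \<and> proj2 C X Y \<cdot> h = g"
    using chosen_is_product[of X Y] assms hom_obj[OF assms(1)] hom_obj[OF assms(2)]
    unfolding is_binary_product_def by blast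
  from theI'[OF this] show "pairing C f g \<in> hom C W (X \<otimes> Y)"
    "proj1 C X Y \<cdot> pairing C f g = f" "proj2 C X Y \<cdot> pairing C f g = g"
    unfolding pairing_def using hom_dom_cod[OF assms(1)] hom_dom_cod[OF assms(2)] by auto
qed

lemma prod_eqI:
  assumes "X \<in> Obj C" "Y \<in> Obj C" "h \<in> hom C W (X \<otimes> Y)" "k \<in> hom C W (X \<otimes> Y)"
    and "proj1 C X Y \<cdot> h = proj1 C X Y \<cdot> k" "proj2 C X Y \<cdot> h = proj2 C X Y \<cdot> k"
  shows "h = k"
proof -
  have "\<exists>!l. l \<in> hom C W (X \<otimes> Y) \<and> proj1 C X Y \<cdot> l = proj1 C X Y \<cdot> k
      \<and> proj2 C X Y \<cdot> l = proj2 C X Y \<cdot> k"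
    using chosen_is_product[OF assms(1,2)] comp_hom[OF assms(4)] proj_hom[OF assms(1,2)]
      hom_obj[OF assms(3)]
    unfolding is_binary_product_def by blast
  then show ?thesis
    using assms(3-) by blast
qed

lemma pairing_comp:
  assumes "f \<in> hom C W X" "g \<in> hom C W Y" "h \<in> hom C V W"
  shows "pairing C f g \<cdot> h = pairing C (f \<cdot> h) (g \<cdot> h)"
proof (rule prod_eqI)
  note o = hom_obj(2)[OF assms(1)] hom_obj(2)[OF assms(2)]
  note p = pairing_props[OF assms(1,2)]
  note p' = pairing_props[OF comp_hom[OF assms(3,1)] comp_hom[OF assms(3,2)]]
  show "X \<in> Obj C" "Y \<in> Obj C" by fact+
  show "pairing C f g \<cdot> h \<in> hom C V (X \<otimes> Y)" by (rule comp_hom[OF assms(3) p(1)])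
  show "pairing C (f \<cdot> h) (g \<cdot> h) \<in> hom C V (X \<otimes> Y)" by (rule p'(1))
  show "proj1 C X Y \<cdot> pairing C f g \<cdot> h = proj1 C X Y \<cdot> pairing C (f \<cdot> h) (g \<cdot> h)"
    using assoc[OF assms(3) p(1) proj_hom(1)[OF o]] p p' by simp
  show "proj2 C X Y \<cdot> pairing C f g \<cdot> h = proj2 C X Y \<cdot> pairing C (f \<cdot> h) (g \<cdot> h)"
    using assoc[OF assms(3) p(1) proj_hom(2)[OF o]] p p' by simp
qed

lemma prod_mor_alt:
  assumes "f \<in> hom C X X'" "g \<in> hom C Y Y'"
  shows "prod_mor C f g = pairing C (f \<cdot> proj1 C X Y) (g \<cdot> proj2 C X Y)"
  unfolding prod_mor_def using hom_dom_cod[OF assms(1)] hom_dom_cod[OF assms(2)] by simp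

lemma prod_mor_hom:
  assumes "f \<in> hom C X X'" "g \<in> hom C Y Y'"
  shows "prod_mor C f g \<in> hom C (X \<otimes> Y) (X' \<otimes> Y')"
  unfolding prod_mor_alt[OF assms]
  by (intro pairing_hom comp_hom[OF proj_hom(1) assms(1)] comp_hom[OF proj_hom(2) assms(2)]
      hom_obj(1)[OF assms(1)] hom_obj(1)[OF assms(2)])

lemma prod_mor_pairing:
  assumes "a \<in> hom C X X'" "b \<in> hom C Y Y'" "f \<in> hom C W X" "g \<in> hom C W Y"
  shows "prod_mor C a b \<cdot> pairing C f g = pairing C (a \<cdot> f) (b \<cdot> g)"
proof -
  note o = hom_obj(1)[OF assms(1)] hom_obj(1)[OF assms(2)]
  note p = pairing_props[OF assms(3,4)]
  show ?thesis
    unfolding prod_mor_alt[OF assms(1,2)]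
      pairing_comp[OF comp_hom[OF proj_hom(1)[OF o] assms(1)]
        comp_hom[OF proj_hom(2)[OF o] assms(2)] p(1)]
      assoc[OF p(1) proj_hom(1)[OF o] assms(1), symmetric]
      assoc[OF p(1) proj_hom(2)[OF o] assms(2), symmetric]
      p ..
qed

lemma prod_mor_comp:
  assumes "a \<in> hom C X X'" "b \<in> hom C Y Y'" "c \<in> hom C X' X''" "d \<in> hom C Y' Y''"
  shows "prod_mor C c d \<cdot> prod_mor C a b = prod_mor C (c \<cdot> a) (d \<cdot> b)"
proof -
  note o = hom_obj(1)[OF assms(1)] hom_obj(1)[OF assms(2)]
  note p = proj_hom[OF o]
  show ?thesis
    unfolding prod_mor_alt[OF assms(1,2)]
      prod_mor_alt[OF comp_hom[OF assms(1,3)] comp_hom[OF assms(2,4)]]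
      prod_mor_pairing[OF assms(3,4) comp_hom[OF p(1) assms(1)] comp_hom[OF p(2) assms(2)]]
      assoc[OF p(1) assms(1,3)] assoc[OF p(2) assms(2,4)] ..
qed

subsection \<open>The axes of a product\<close>

text \<open>The injections \<open>inj1\<close> and \<open>inj2\<close> live on squares \<open>X \<times> X\<close>; factoring along a product of two
  different quotient maps needs the axes of an arbitrary product.\<close>

definition axis1 :: "'o \<Rightarrow> 'o \<Rightarrow> 'm" where
  "axis1 X Y = pairing C (Ide C X) (zero_mor C X Y)"

definition axis2 :: "'o \<Rightarrow> 'o \<Rightarrow> 'm" where
  "axis2 X Y = pairing C (zero_mor C Y X) (Ide C Y)"

lemma inj1_eq_axis1: "inj1 C X = axis1 X X"
  by (simp add: inj1_def axis1_def)

lemma inj2_eq_axis2: "inj2 C X = axis2 X X"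
  by (simp add: inj2_def axis2_def)

lemma axis_hom:
  assumes "X \<in> Obj C" "Y \<in> Obj C"
  shows "axis1 X Y \<in> hom C X (X \<otimes> Y)" "axis2 X Y \<in> hom C Y (X \<otimes> Y)"
  unfolding axis1_def axis2_def by (intro pairing_hom ide_hom zero_hom assms)+

lemma prod_mor_axis:
  assumes "f \<in> hom C X X'" "g \<in> hom C Y Y'"
  shows "prod_mor C f g \<cdot> axis1 X Y = axis1 X' Y' \<cdot> f"
    and "prod_mor C f g \<cdot> axis2 X Y = axis2 X' Y' \<cdot> g"
proof -
  note o = hom_obj[OF assms(1)] hom_obj[OF assms(2)]
  show "prod_mor C f g \<cdot> axis1 X Y = axis1 X' Y' \<cdot> f"
    unfolding axis1_def
      prod_mor_pairing[OF assms ide_hom[OF o(1)] zero_hom[OF o(1,3)]]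
      pairing_comp[OF ide_hom[OF o(2)] zero_hom[OF o(2,4)] assms(1)]
    by (simp add: comp_ide[OF assms(1)] ide_comp[OF assms(1)] comp_zero[OF o(1) assms(2)]
        zero_comp[OF o(4) assms(1)])
  show "prod_mor C f g \<cdot> axis2 X Y = axis2 X' Y' \<cdot> g"
    unfolding axis2_def
      prod_mor_pairing[OF assms zero_hom[OF o(3,1)] ide_hom[OF o(3)]]
      pairing_comp[OF zero_hom[OF o(4,2)] ide_hom[OF o(4)] assms(2)]
    by (simp add: comp_ide[OF assms(2)] ide_comp[OF assms(2)] comp_zero[OF o(3) assms(1)]
        zero_comp[OF o(2) assms(2)])
qed

lemma prod_mor_zero:
  assumes "f \<in> hom C X X'" "g \<in> hom C Y Y'"
  shows "prod_mor C f (zero_mor C Y Y') = axis1 X' Y' \<cdot> f \<cdot> proj1 C X Y"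
    and "prod_mor C (zero_mor C X X') g = axis2 X' Y' \<cdot> g \<cdot> proj2 C X Y"
proof -
  note o = hom_obj[OF assms(1)] hom_obj[OF assms(2)]
  note p = proj_hom[OF o(1,3)]
  note fp = comp_hom[OF p(1) assms(1)] and gp = comp_hom[OF p(2) assms(2)]
  show "prod_mor C f (zero_mor C Y Y') = axis1 X' Y' \<cdot> f \<cdot> proj1 C X Y"
    unfolding axis1_def prod_mor_alt[OF assms(1) zero_hom[OF o(3,4)]]
      pairing_comp[OF ide_hom[OF o(2)] zero_hom[OF o(2,4)] fp]
    by (simp add: ide_comp[OF fp] zero_comp[OF o(4) fp] zero_comp[OF o(4) p(2)])
  show "prod_mor C (zero_mor C X X') g = axis2 X' Y' \<cdot> g \<cdot> proj2 C X Y"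
    unfolding axis2_def prod_mor_alt[OF zero_hom[OF o(1,2)] assms(2)]
      pairing_comp[OF zero_hom[OF o(4,2)] ide_hom[OF o(4)] gp]
    by (simp add: ide_comp[OF gp] zero_comp[OF o(2) gp] zero_comp[OF o(2) p(1)])
qed

subsection \<open>Coequalisers and regular epimorphisms\<close>

lemma coequaliser_hom:
  assumes "is_coequaliser C u v q" "q \<in> hom C Y Q"
  shows "u \<in> hom C (Dom C u) Y" "v \<in> hom C (Dom C u) Y" "q \<cdot> u = q \<cdot> v"
  using assms hom_dom_cod[OF assms(2)] unfolding is_coequaliser_def hom_def by auto

lemma coequaliser_factor:
  assumes "is_coequaliser C u v q" "q \<in> hom C Y Q" "f \<in> hom C Y Z" "f \<cdot> u = f \<cdot> v"
  obtains g where "g \<in> hom C Q Z" "g \<cdot> q = f"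
  using assms hom_dom_cod[OF assms(2)] unfolding is_coequaliser_def by blast

lemma coequaliserI:
  assumes "u \<in> hom C X Y" "v \<in> hom C X Y" "q \<in> hom C Y Q" "q \<cdot> u = q \<cdot> v"
    and "\<And>Z f. \<lbrakk>f \<in> hom C Y Z; f \<cdot> u = f \<cdot> v\<rbrakk> \<Longrightarrow> \<exists>g \<in> hom C Q Z. g \<cdot> q = f"
    and "\<And>Z g h. \<lbrakk>g \<in> hom C Q Z; h \<in> hom C Q Z; g \<cdot> q = h \<cdot> q\<rbrakk> \<Longrightarrow> g = h"
  shows "is_coequaliser C u v q"
proof -
  have "\<exists>!g. g \<in> hom C Q Z \<and> g \<cdot> q = f" if "f \<in> hom C Y Z" "f \<cdot> u = f \<cdot> v" for Z f
    using assms(5)[OF that] assms(6) by blast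
  then show ?thesis
    unfolding is_coequaliser_def
    using hom_dom_cod[OF assms(1)] hom_dom_cod[OF assms(2)] hom_dom_cod[OF assms(3)] assms(4)
    by simp
qed

lemma regular_epi_cancel:
  assumes "regular_epi C q" "q \<in> hom C Y Q" "g \<in> hom C Q Z" "h \<in> hom C Q Z" "g \<cdot> q = h \<cdot> q"
  shows "g = h"
proof -
  obtain u v where uv: "is_coequaliser C u v q"
    using assms(1) unfolding regular_epi_def by blast
  note c = coequaliser_hom[OF uv assms(2)]
  have "(h \<cdot> q) \<cdot> u = (h \<cdot> q) \<cdot> v"
    using assoc[OF c(1) assms(2,4)] assoc[OF c(2) assms(2,4)] c(3) by simp
  then have "\<exists>!k. k \<in> hom C Q Z \<and> k \<cdot> q = h \<cdot> q"
    using uv comp_hom[OF assms(2,4)] hom_dom_cod[OF assms(2)] unfolding is_coequaliser_def by blast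
  then show ?thesis
    using assms(3-5) by blast
qed

lemma ide_coequaliser_zero:
  assumes "X \<in> Obj C"
  shows "is_coequaliser C (zero_mor C X X) (zero_mor C X X) (Ide C X)"
proof (rule coequaliserI[OF zero_hom[OF assms assms] zero_hom[OF assms assms] ide_hom[OF assms]])
  fix Z f assume "f \<in> hom C X Z"
  then show "\<exists>g\<in>hom C X Z. g \<cdot> Ide C X = f"
    using comp_ide by blast
next
  fix Z g h assume "g \<in> hom C X Z" "h \<in> hom C X Z" "g \<cdot> Ide C X = h \<cdot> Ide C X"
  then show "g = h"
    by (simp add: comp_ide)
qed simp

lemma regular_epi_comp_iso:
  assumes "regular_epi C e" "e \<in> hom C X A" "h \<in> hom C A B" "k \<in> hom C B A"
    and "k \<cdot> h = Ide C A" "h \<cdot> k = Ide C B"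
  shows "regular_epi C (h \<cdot> e)"
proof -
  obtain u v where uv: "is_coequaliser C u v e"
    using assms(1) unfolding regular_epi_def by blast
  note c = coequaliser_hom[OF uv assms(2)]
  have ke: "k \<cdot> h \<cdot> e = e"
    using assoc[OF assms(2-4)] ide_comp[OF assms(2)] assms(5) by simp
  have "is_coequaliser C u v (h \<cdot> e)"
  proof (rule coequaliserI[OF c(1,2) comp_hom[OF assms(2,3)]])
    show "(h \<cdot> e) \<cdot> u = (h \<cdot> e) \<cdot> v"
      using assoc[OF c(1) assms(2,3)] assoc[OF c(2) assms(2,3)] c(3) by simp
  next
    fix Z f assume f: "f \<in> hom C X Z" "f \<cdot> u = f \<cdot> v"
    obtain g where g: "g \<in> hom C A Z" "g \<cdot> e = f"
      using coequaliser_factor[OF uv assms(2) f] .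
    have "(g \<cdot> k) \<cdot> h \<cdot> e = f"
      using assoc[OF comp_hom[OF assms(2,3)] assms(4) g(1)] ke g(2) by simp
    then show "\<exists>g\<in>hom C B Z. g \<cdot> h \<cdot> e = f"
      using comp_hom[OF assms(4) g(1)] by blast
  next
    fix Z g g' assume g: "g \<in> hom C B Z" "g' \<in> hom C B Z" "g \<cdot> h \<cdot> e = g' \<cdot> h \<cdot> e"
    have "g \<cdot> h = g' \<cdot> h"
      using regular_epi_cancel[OF assms(1,2) comp_hom[OF assms(3) g(1)] comp_hom[OF assms(3) g(2)]]
        g(3) assoc[OF assms(2,3) g(1)] assoc[OF assms(2,3) g(2)] by simp
    then have "(g \<cdot> h) \<cdot> k = (g' \<cdot> h) \<cdot> k"
      by simp
    then show "g = g'"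
      using assoc[OF assms(4,3) g(1)] assoc[OF assms(4,3) g(2)] assms(6)
        comp_ide[OF g(1)] comp_ide[OF g(2)] by simp
  qed
  then show ?thesis
    unfolding regular_epi_def by blast
qed

lemma mono_regular_epi_iso:
  assumes "regular_epi C e" "e \<in> hom C X A"
    and mono: "\<And>W f g. \<lbrakk>f \<in> hom C W X; g \<in> hom C W X; e \<cdot> f = e \<cdot> g\<rbrakk> \<Longrightarrow> f = g"
  obtains d where "d \<in> hom C A X" "d \<cdot> e = Ide C X" "e \<cdot> d = Ide C A"
proof -
  note o = hom_obj[OF assms(2)]
  obtain u v where uv: "is_coequaliser C u v e"
    using assms(1) unfolding regular_epi_def by blast
  note c = coequaliser_hom[OF uv assms(2)]
  have "u = v"
    using mono[OF c] .
  then obtain d where d: "d \<in> hom C A X" "d \<cdot> e = Ide C X"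
    using coequaliser_factor[OF uv assms(2) ide_hom[OF o(1)]] by blast
  have "(e \<cdot> d) \<cdot> e = Ide C A \<cdot> e"
    using assoc[OF assms(2) d(1) assms(2)] d(2) comp_ide[OF assms(2)] ide_comp[OF assms(2)] by simp
  then have "e \<cdot> d = Ide C A"
    using regular_epi_cancel[OF assms(1,2) comp_hom[OF d(1) assms(2)] ide_hom[OF o(2)]] by blast
  then show thesis
    using that d by blast
qed

text \<open>An object \<open>R\<close> over \<open>A\<close> and \<open>B\<close> is a product as soon as the comparison morphism to \<open>A \<otimes> B\<close> is
  invertible.\<close>

lemma binary_productI:
  assumes "A \<in> Obj C" "B \<in> Obj C" "p \<in> hom C R A" "q \<in> hom C R B"
    and k: "k \<in> hom C (A \<otimes> B) R"
    and kp: "k \<cdot> pairing C p q = Ide C R" and pk: "pairing C p q \<cdot> k = Ide C (A \<otimes> B)"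
  shows "is_binary_product C A B R p q"
proof -
  note pq = pairing_props[OF assms(3,4)]
  note pr = proj_hom[OF assms(1,2)]
  have pk': "p \<cdot> k = proj1 C A B" "q \<cdot> k = proj2 C A B"
    using assoc[OF k pq(1) pr(1)] assoc[OF k pq(1) pr(2)] pk comp_ide[OF pr(1)] comp_ide[OF pr(2)] pq
    by simp_all
  have "\<exists>!h. h \<in> hom C W R \<and> p \<cdot> h = f \<and> q \<cdot> h = g"
    if f: "f \<in> hom C W A" and g: "g \<in> hom C W B" for W f g
  proof (rule ex1I)
    note fg = pairing_props[OF f g]
    show "k \<cdot> pairing C f g \<in> hom C W R \<and> p \<cdot> k \<cdot> pairing C f g = f \<and> q \<cdot> k \<cdot> pairing C f g = g"
      using comp_hom[OF fg(1) k] assoc[OF fg(1) k assms(3)] assoc[OF fg(1) k assms(4)] pk' fg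
      by simp
    fix h assume h: "h \<in> hom C W R \<and> p \<cdot> h = f \<and> q \<cdot> h = g"
    then have "h = (k \<cdot> pairing C p q) \<cdot> h"
      using kp ide_comp[of h W R] by simp
    also have "\<dots> = k \<cdot> pairing C f g"
      using assoc[of h W R _ "A \<otimes> B" k R, OF _ pq(1) k] h pairing_comp[OF assms(3,4), of h W] by simp
    finally show "h = k \<cdot> pairing C f g" .
  qed
  then show ?thesis
    unfolding is_binary_product_def using assms hom_obj(1)[OF assms(3)] by blast
qed

lemma binary_product_factor:
  assumes "is_binary_product C X Y P p q" "f \<in> hom C W X" "g \<in> hom C W Y"
  shows "\<exists>!h. h \<in> hom C W P \<and> p \<cdot> h = f \<and> q \<cdot> h = g"
  using assms hom_obj(1)[OF assms(2)] unfolding is_binary_product_def by simp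

lemma binary_product_iso:
  assumes "is_binary_product C X Y P p q"
  obtains j where "j \<in> hom C (X \<otimes> Y) P"
    "j \<cdot> pairing C p q = Ide C P" "pairing C p q \<cdot> j = Ide C (X \<otimes> Y)"
proof -
  have o: "X \<in> Obj C" "Y \<in> Obj C" "P \<in> Obj C" and pq: "p \<in> hom C P X" "q \<in> hom C P Y"
    using assms unfolding is_binary_product_def by auto
  note uni = binary_product_factor[OF assms]
  note pr = proj_hom[OF o(1,2)]
  note k = pairing_props[OF pq]
  obtain j where j: "j \<in> hom C (X \<otimes> Y) P" "p \<cdot> j = proj1 C X Y" "q \<cdot> j = proj2 C X Y"
    using uni[OF pr] by blast
  have "j \<cdot> pairing C p q = Ide C P"
  proof -
    have "j \<cdot> pairing C p q \<in> hom C P P \<and> p \<cdot> j \<cdot> pairing C p q = p \<and> q \<cdot> j \<cdot> pairing C p q = q"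
      using comp_hom[OF k(1) j(1)] assoc[OF k(1) j(1) pq(1)] assoc[OF k(1) j(1) pq(2)] j k by simp
    then show ?thesis
      using uni[OF pq] ide_hom[OF o(3)] comp_ide[OF pq(1)] comp_ide[OF pq(2)] by blast
  qed
  moreover have "pairing C p q \<cdot> j = Ide C (X \<otimes> Y)"
    using assoc[OF j(1) k(1) pr(1)] assoc[OF j(1) k(1) pr(2)] j k comp_ide[OF pr(1)] comp_ide[OF pr(2)]
    by (intro prod_eqI[OF o(1,2) comp_hom[OF j(1) k(1)] ide_hom[OF prd_obj[OF o(1,2)]]]) simp_all
  ultimately show thesis
    using that j(1) by blast
qed

section \<open>Commutative objects\<close>

lemma commutative_objectI:
  assumes "X \<in> Obj C" "\<rho> \<in> hom C (X \<otimes> X) X" "\<rho> \<cdot> axis1 X X = Ide C X" "\<rho> \<cdot> axis2 X X = Ide C X"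
  shows "commutative_object C X"
  using assms unfolding commutative_object_def inj1_eq_axis1 inj2_eq_axis2 by blast

lemma commutative_objectE:
  assumes "commutative_object C X"
  obtains \<rho> where "X \<in> Obj C" "\<rho> \<in> hom C (X \<otimes> X) X"
    "\<rho> \<cdot> axis1 X X = Ide C X" "\<rho> \<cdot> axis2 X X = Ide C X"
  using assms unfolding commutative_object_def inj1_eq_axis1 inj2_eq_axis2 by blast

text \<open>A multiplication on \<open>Y\<close> extends every morphism \<open>X \<rightarrow> Y\<close> from the axes to the square: the axes are
  natural in the object, and the multiplication is unital on them.\<close>

lemma mult_prod_mor_axis:
  assumes "\<rho> \<in> hom C (Y \<otimes> Y) Y" "\<rho> \<cdot> axis1 Y Y = Ide C Y" "\<rho> \<cdot> axis2 Y Y = Ide C Y" "f \<in> hom C X Y"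
  shows "(\<rho> \<cdot> prod_mor C f f) \<cdot> axis1 X X = f" "(\<rho> \<cdot> prod_mor C f f) \<cdot> axis2 X X = f"
proof -
  note o = hom_obj[OF assms(4)]
  note a = axis_hom[OF o(1,1)] and b = axis_hom[OF o(2,2)] and ff = prod_mor_hom[OF assms(4,4)]
  show "(\<rho> \<cdot> prod_mor C f f) \<cdot> axis1 X X = f"
    using assoc[OF a(1) ff assms(1)] prod_mor_axis[OF assms(4,4)] assoc[OF assms(4) b(1) assms(1)]
      assms(2) ide_comp[OF assms(4)] by simp
  show "(\<rho> \<cdot> prod_mor C f f) \<cdot> axis2 X X = f"
    using assoc[OF a(2) ff assms(1)] prod_mor_axis[OF assms(4,4)] assoc[OF assms(4) b(2) assms(1)]
      assms(3) ide_comp[OF assms(4)] by simp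
qed

text \<open>The multiplication of a product is formed componentwise.\<close>

lemma commutative_object_product:
  assumes "is_product C I X P p" "\<And>i. i \<in> I \<Longrightarrow> commutative_object C (X i)"
  shows "commutative_object C P"
proof -
  have P: "P \<in> Obj C" and p: "\<And>i. i \<in> I \<Longrightarrow> p i \<in> hom C P (X i)"
    using assms(1) unfolding is_product_def by auto
  have uni: "\<exists>!h. h \<in> hom C W P \<and> (\<forall>i \<in> I. p i \<cdot> h = f i)"
    if "W \<in> Obj C" "\<And>i. i \<in> I \<Longrightarrow> f i \<in> hom C W (X i)" for W f
    using assms(1) that unfolding is_product_def by blast
  have "\<forall>i \<in> I. \<exists>\<rho>. \<rho> \<in> hom C (X i \<otimes> X i) (X i) \<and>
      \<rho> \<cdot> axis1 (X i) (X i) = Ide C (X i) \<and> \<rho> \<cdot> axis2 (X i) (X i) = Ide C (X i)"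
    using assms(2) by (meson commutative_objectE)
  then obtain \<rho> where \<rho>: "\<And>i. i \<in> I \<Longrightarrow> \<rho> i \<in> hom C (X i \<otimes> X i) (X i)"
    "\<And>i. i \<in> I \<Longrightarrow> \<rho> i \<cdot> axis1 (X i) (X i) = Ide C (X i)"
    "\<And>i. i \<in> I \<Longrightarrow> \<rho> i \<cdot> axis2 (X i) (X i) = Ide C (X i)"
    by metis
  define m where "m i = \<rho> i \<cdot> prod_mor C (p i) (p i)" for i
  have m: "m i \<in> hom C (P \<otimes> P) (X i)" "m i \<cdot> axis1 P P = p i" "m i \<cdot> axis2 P P = p i"
    if "i \<in> I" for i
    unfolding m_def
    using comp_hom[OF prod_mor_hom[OF p[OF that] p[OF that]] \<rho>(1)[OF that]]
      mult_prod_mor_axis[OF \<rho>(1-3)[OF that] p[OF that]] by auto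
  obtain \<mu> where \<mu>: "\<mu> \<in> hom C (P \<otimes> P) P" "\<And>i. i \<in> I \<Longrightarrow> p i \<cdot> \<mu> = m i"
    using uni[OF prd_obj[OF P P], of m] m(1) by blast
  have unit: "\<mu> \<cdot> a = Ide C P"
    if a: "a \<in> hom C P (P \<otimes> P)" "\<And>i. i \<in> I \<Longrightarrow> m i \<cdot> a = p i" for a
  proof -
    have "\<mu> \<cdot> a \<in> hom C P P" "\<forall>i \<in> I. p i \<cdot> \<mu> \<cdot> a = p i"
      using comp_hom[OF a(1) \<mu>(1)] assoc[OF a(1) \<mu>(1) p] \<mu>(2) a(2) by auto
    moreover have "\<forall>i \<in> I. p i \<cdot> Ide C P = p i"
      using comp_ide[OF p] by blast
    ultimately show ?thesis
      using uni[OF P p] ide_hom[OF P] by blast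
  qed
  show ?thesis
    by (rule commutative_objectI[OF P \<mu>(1) unit unit])
      (use axis_hom[OF P P] m in auto)
qed

text \<open>A binary product is a product indexed by the booleans.\<close>

lemma commutative_object_binary_product:
  assumes "is_binary_product C X Y P p q" "commutative_object C X" "commutative_object C Y"
  shows "commutative_object C P"
proof (rule commutative_object_product)
  let ?X = "\<lambda>b. if b then X else Y" and ?p = "\<lambda>b. if b then p else q"
  show "is_product C (UNIV :: bool set) ?X P ?p"
    unfolding is_product_def
  proof (intro conjI ballI allI impI)
    fix W and f :: "bool \<Rightarrow> 'm"
    assume "W \<in> Obj C" "\<forall>b \<in> UNIV. f b \<in> hom C W (?X b)"
    then have "f True \<in> hom C W X" "f False \<in> hom C W Y"
      by (simp_all add: all_bool_eq)
    from binary_product_factor[OF assms(1) this]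
    show "\<exists>!h. h \<in> hom C W P \<and> (\<forall>b \<in> UNIV. ?p b \<cdot> h = f b)"
      by (simp add: all_bool_eq)
  qed (use assms(1) in \<open>auto simp: is_binary_product_def\<close>)
  show "commutative_object C (?X b)" if "b \<in> UNIV" for b
    using assms by simp
qed

text \<open>A retract \<open>d e = 1\<close> of \<open>(A, \<rho>)\<close> inherits the multiplication \<open>d \<rho> (e \<times> e)\<close>.\<close>

lemma commutative_object_retract:
  assumes "commutative_object C A" "e \<in> hom C X A" "d \<in> hom C A X" "d \<cdot> e = Ide C X"
  shows "commutative_object C X"
proof -
  obtain \<rho> where \<rho>: "\<rho> \<in> hom C (A \<otimes> A) A" "\<rho> \<cdot> axis1 A A = Ide C A" "\<rho> \<cdot> axis2 A A = Ide C A"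
    using commutative_objectE[OF assms(1)] by blast
  note X = hom_obj(1)[OF assms(2)]
  note m = comp_hom[OF prod_mor_hom[OF assms(2,2)] \<rho>(1)]
  note me = mult_prod_mor_axis[OF \<rho> assms(2)]
  show ?thesis
  proof (rule commutative_objectI[OF X comp_hom[OF m assms(3)]])
    show "(d \<cdot> \<rho> \<cdot> prod_mor C e e) \<cdot> axis1 X X = Ide C X"
      using assoc[OF axis_hom(1)[OF X X] m assms(3)] me(1) assms(4) by simp
    show "(d \<cdot> \<rho> \<cdot> prod_mor C e e) \<cdot> axis2 X X = Ide C X"
      using assoc[OF axis_hom(2)[OF X X] m assms(3)] me(2) assms(4) by simp
  qed
qed

text \<open>A reflection arrow of a single object, so that the construction of the reflection and the
  properties of an arbitrary reflection can be treated alike.\<close>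

definition commutative_reflection :: "'o \<Rightarrow> 'o \<Rightarrow> 'm \<Rightarrow> bool" where
  "commutative_reflection X A e \<longleftrightarrow> e \<in> hom C X A \<and> commutative_object C A \<and>
     (\<forall>Z. commutative_object C Z \<longrightarrow> (\<forall>f \<in> hom C X Z. \<exists>!g. g \<in> hom C A Z \<and> g \<cdot> e = f))"

lemma commutative_reflectionD:
  assumes "commutative_reflection X A e"
  shows "e \<in> hom C X A" "commutative_object C A"
    and "\<And>Z f. \<lbrakk>commutative_object C Z; f \<in> hom C X Z\<rbrakk> \<Longrightarrow> \<exists>!g. g \<in> hom C A Z \<and> g \<cdot> e = f"
  using assms unfolding commutative_reflection_def by auto

lemma commutative_reflection_iso:
  assumes "commutative_reflection X A e" "commutative_reflection X B e'"
  obtains h k where "h \<in> hom C A B" "k \<in> hom C B A" "k \<cdot> h = Ide C A" "h \<cdot> k = Ide C B" "h \<cdot> e = e'"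
proof -
  note A = commutative_reflectionD[OF assms(1)] and B = commutative_reflectionD[OF assms(2)]
  obtain h where h: "h \<in> hom C A B" "h \<cdot> e = e'"
    using A(3)[OF B(2,1)] by blast
  obtain k where k: "k \<in> hom C B A" "k \<cdot> e' = e"
    using B(3)[OF A(2,1)] by blast
  have "(k \<cdot> h) \<cdot> e = e" "Ide C A \<cdot> e = e"
    using assoc[OF A(1) h(1) k(1)] h k ide_comp[OF A(1)] by simp_all
  then have "k \<cdot> h = Ide C A"
    using A(3)[OF A(2,1)] comp_hom[OF h(1) k(1)] ide_hom[OF hom_obj(2)[OF A(1)]] by blast
  moreover have "(h \<cdot> k) \<cdot> e' = e'" "Ide C B \<cdot> e' = e'"
    using assoc[OF B(1) k(1) h(1)] h k ide_comp[OF B(1)] by simp_all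
  then have "h \<cdot> k = Ide C B"
    using B(3)[OF B(2,1)] comp_hom[OF k(1) h(1)] ide_hom[OF hom_obj(2)[OF B(1)]] by blast
  ultimately show thesis
    using that h k by blast
qed

lemma Obj_Com: "X \<in> Obj (Com C) \<longleftrightarrow> commutative_object C X"
  unfolding Com_def full_subcat_def commutative_object_def by auto

lemma hom_Com:
  "f \<in> hom (Com C) X Y \<longleftrightarrow> f \<in> hom C X Y \<and> commutative_object C X \<and> commutative_object C Y"
  unfolding Com_def full_subcat_def hom_def by auto

lemma Com_sel [simp]: "Comp (Com C) = Comp C" "Ide (Com C) = Ide C"
  "Dom (Com C) = Dom C" "Cod (Com C) = Cod C"
  unfolding Com_def full_subcat_def by auto

lemma reflection_props:
  assumes "is_reflection C (Com C) r \<eta>"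
  shows reflection_commutative_reflection:
      "X \<in> Obj C \<Longrightarrow> commutative_reflection X (on_obj r X) (\<eta> X)"
    and reflection_arr_hom: "f \<in> hom C X Y \<Longrightarrow> on_arr r f \<in> hom C (on_obj r X) (on_obj r Y)"
    and reflection_natural: "f \<in> hom C X Y \<Longrightarrow> on_arr r f \<cdot> \<eta> X = \<eta> Y \<cdot> f"
proof -
  have adj: "is_left_adjoint C (Com C) r \<lparr>on_obj = \<lambda>X. X, on_arr = \<lambda>f. f\<rparr> \<eta>"
    using assms unfolding is_reflection_def inclusion_def .
  have "is_functor C (Com C) r"
    and nat: "\<forall>X Y. \<forall>f \<in> hom C X Y. on_arr r f \<cdot> \<eta> X = \<eta> Y \<cdot> f"
    and unit: "\<forall>X \<in> Obj C. \<eta> X \<in> hom C X (on_obj r X)"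
    and univ: "\<forall>X \<in> Obj C. \<forall>Y \<in> Obj (Com C). \<forall>f \<in> hom C X Y.
        \<exists>!g. g \<in> hom (Com C) (on_obj r X) Y \<and> g \<cdot> \<eta> X = f"
    using adj unfolding is_left_adjoint_def by simp_all
  then have obj: "\<forall>X \<in> Obj C. on_obj r X \<in> Obj (Com C)"
    and arr: "\<forall>X Y. \<forall>f \<in> hom C X Y. on_arr r f \<in> hom (Com C) (on_obj r X) (on_obj r Y)"
    unfolding is_functor_def by simp_all
  show "commutative_reflection X (on_obj r X) (\<eta> X)" if X: "X \<in> Obj C"
    using bspec[OF obj X] bspec[OF unit X] bspec[OF univ X]
    unfolding commutative_reflection_def by (simp add: Obj_Com hom_Com)
  show "on_arr r f \<in> hom C (on_obj r X) (on_obj r Y)" if "f \<in> hom C X Y"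
    using arr that by (simp add: hom_Com)
  show "on_arr r f \<cdot> \<eta> X = \<eta> Y \<cdot> f" if "f \<in> hom C X Y"
    using nat that by simp
qed

text \<open>Reflection arrows for the single objects assemble into a left adjoint of the inclusion.\<close>

lemma reflectiveI:
  assumes "\<And>X. X \<in> Obj C \<Longrightarrow> \<exists>A e. commutative_reflection X A e"
  shows "reflective C (Com C)"
proof -
  obtain R \<eta> where refl: "\<And>X. X \<in> Obj C \<Longrightarrow> commutative_reflection X (R X) (\<eta> X)"
    using assms by metis
  note R = commutative_reflectionD[OF refl]
  define F where "F f = (THE g. g \<in> hom C (R (Dom C f)) (R (Cod C f)) \<and>
      g \<cdot> \<eta> (Dom C f) = \<eta> (Cod C f) \<cdot> f)" for f
  have F: "F f \<in> hom C (R X) (R Y)" "F f \<cdot> \<eta> X = \<eta> Y \<cdot> f" if f: "f \<in> hom C X Y" for f X Y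
  proof -
    note o = hom_obj[OF f]
    have "\<exists>!g. g \<in> hom C (R X) (R Y) \<and> g \<cdot> \<eta> X = \<eta> Y \<cdot> f"
      using R(3)[OF o(1) R(2)[OF o(2)] comp_hom[OF f R(1)[OF o(2)]]] .
    from theI'[OF this] show "F f \<in> hom C (R X) (R Y)" "F f \<cdot> \<eta> X = \<eta> Y \<cdot> f"
      unfolding F_def using hom_dom_cod[OF f] by auto
  qed
  have F_unique: "F f = g"
    if f: "f \<in> hom C X Y" and g: "g \<in> hom C (R X) (R Y)" "g \<cdot> \<eta> X = \<eta> Y \<cdot> f" for f g X Y
    using R(3)[OF hom_obj(1)[OF f] R(2)[OF hom_obj(2)[OF f]] comp_hom[OF f R(1)[OF hom_obj(2)[OF f]]]]
      F[OF f] g by blast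
  have F_ide: "F (Ide C X) = Ide C (R X)" if X: "X \<in> Obj C" for X
    using R(1)[OF X] hom_obj(2) by (intro F_unique[OF ide_hom[OF X]] ide_hom)
      (auto simp: ide_comp[OF R(1)[OF X]] comp_ide[OF R(1)[OF X]])
  have F_comp: "F (g \<cdot> f) = F g \<cdot> F f" if f: "f \<in> hom C X Y" and g: "g \<in> hom C Y Z" for f g X Y Z
  proof (rule F_unique[OF comp_hom[OF f g] comp_hom[OF F(1)[OF f] F(1)[OF g]]])
    note o = hom_obj[OF f] hom_obj(2)[OF g]
    have "(F g \<cdot> F f) \<cdot> \<eta> X = F g \<cdot> \<eta> Y \<cdot> f"
      using assoc[OF R(1)[OF o(1)] F(1)[OF f] F(1)[OF g]] F(2)[OF f] by simp
    also have "\<dots> = \<eta> Z \<cdot> g \<cdot> f"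
      using assoc[OF f R(1)[OF o(2)] F(1)[OF g]] F(2)[OF g] assoc[OF f g R(1)[OF o(3)]] by simp
    finally show "(F g \<cdot> F f) \<cdot> \<eta> X = \<eta> Z \<cdot> g \<cdot> f" .
  qed
  let ?r = "\<lparr>on_obj = R, on_arr = F\<rparr>"
  have "is_functor C (Com C) ?r"
    unfolding is_functor_def
    using R(2) F(1) F_ide F_comp hom_obj by (auto simp: Obj_Com hom_Com)
  moreover have "is_functor (Com C) C inclusion"
    unfolding is_functor_def inclusion_def by (auto simp: Obj_Com hom_Com commutative_object_def)
  ultimately have "is_left_adjoint C (Com C) ?r inclusion \<eta>"
    unfolding is_left_adjoint_def
    using R F(2) by (auto simp: inclusion_def Obj_Com hom_Com)
  then show ?thesis
    unfolding reflective_def is_reflection_def by blast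
qed

end

section \<open>Products commuting with coequalisers\<close>

locale pointed_category_products_coequalisers = pointed_category_with_products +
  assumes coeqs: "has_coequalisers C"
    and comm: "products_commute_with_coequalisers C"
begin

lemma regular_epi_prod_mor:
  assumes "regular_epi C e" "regular_epi C e'"
  shows "regular_epi C (prod_mor C e e')"
  using assms comm unfolding regular_epi_def products_commute_with_coequalisers_def by blast

text \<open>The morphism \<open>1 \<times> e\<close> is a coequaliser of \<open>0 \<times> s\<close> and \<open>0 \<times> t\<close>, which are \<open>s\<close> and \<open>t\<close> after the
  second projection and followed by the second axis; hence only the restriction of \<open>\<phi>\<close> to that axis
  matters.\<close>

lemma factor_through_second:
  assumes "regular_epi C e" "e \<in> hom C Y Y'" "X \<in> Obj C" "\<phi> \<in> hom C (X \<otimes> Y) Z"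
    and "b \<in> hom C Y' Z" "\<phi> \<cdot> axis2 X Y = b \<cdot> e"
  obtains \<psi> where "\<psi> \<in> hom C (X \<otimes> Y') Z" "\<psi> \<cdot> prod_mor C (Ide C X) e = \<phi>"
proof -
  obtain s t where st: "is_coequaliser C s t e"
    using assms(1) unfolding regular_epi_def by blast
  note c = coequaliser_hom[OF st assms(2)]
  let ?O = "zero_mor C X X" and ?S = "Dom C s"
  have co: "is_coequaliser C (prod_mor C ?O s) (prod_mor C ?O t) (prod_mor C (Ide C X) e)"
    using comm ide_coequaliser_zero[OF assms(3)] st
    unfolding products_commute_with_coequalisers_def by blast
  note a = axis_hom(2)[OF assms(3) hom_obj(1)[OF assms(2)]]
  have *: "\<phi> \<cdot> prod_mor C ?O w = (b \<cdot> e \<cdot> w) \<cdot> proj2 C X ?S" if w: "w \<in> hom C ?S Y" for w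
  proof -
    note p = proj_hom(2)[OF assms(3) hom_obj(1)[OF w]]
    have "\<phi> \<cdot> prod_mor C ?O w = (\<phi> \<cdot> axis2 X Y) \<cdot> w \<cdot> proj2 C X ?S"
      using prod_mor_zero(2)[OF zero_hom[OF assms(3,3)] w] assoc[OF comp_hom[OF p w] a assms(4)]
      by simp
    also have "\<dots> = (b \<cdot> e \<cdot> w) \<cdot> proj2 C X ?S"
      using assms(6) assoc[OF p w comp_hom[OF assms(2,5)]] assoc[OF w assms(2,5)] by simp
    finally show ?thesis .
  qed
  have "\<phi> \<cdot> prod_mor C ?O s = \<phi> \<cdot> prod_mor C ?O t"
    using *[OF c(1)] *[OF c(2)] c(3) by simp
  from coequaliser_factor[OF co prod_mor_hom[OF ide_hom[OF assms(3)] assms(2)] assms(4) this] that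
  show thesis by blast
qed

lemma factor_through_first:
  assumes "regular_epi C e" "e \<in> hom C X X'" "Y \<in> Obj C" "\<phi> \<in> hom C (X \<otimes> Y) Z"
    and "b \<in> hom C X' Z" "\<phi> \<cdot> axis1 X Y = b \<cdot> e"
  obtains \<psi> where "\<psi> \<in> hom C (X' \<otimes> Y) Z" "\<psi> \<cdot> prod_mor C e (Ide C Y) = \<phi>"
proof -
  obtain s t where st: "is_coequaliser C s t e"
    using assms(1) unfolding regular_epi_def by blast
  note c = coequaliser_hom[OF st assms(2)]
  let ?O = "zero_mor C Y Y" and ?S = "Dom C s"
  have co: "is_coequaliser C (prod_mor C s ?O) (prod_mor C t ?O) (prod_mor C e (Ide C Y))"
    using comm ide_coequaliser_zero[OF assms(3)] st
    unfolding products_commute_with_coequalisers_def by blast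
  note a = axis_hom(1)[OF hom_obj(1)[OF assms(2)] assms(3)]
  have *: "\<phi> \<cdot> prod_mor C w ?O = (b \<cdot> e \<cdot> w) \<cdot> proj1 C ?S Y" if w: "w \<in> hom C ?S X" for w
  proof -
    note p = proj_hom(1)[OF hom_obj(1)[OF w] assms(3)]
    have "\<phi> \<cdot> prod_mor C w ?O = (\<phi> \<cdot> axis1 X Y) \<cdot> w \<cdot> proj1 C ?S Y"
      using prod_mor_zero(1)[OF w zero_hom[OF assms(3,3)]] assoc[OF comp_hom[OF p w] a assms(4)]
      by simp
    also have "\<dots> = (b \<cdot> e \<cdot> w) \<cdot> proj1 C ?S Y"
      using assms(6) assoc[OF p w comp_hom[OF assms(2,5)]] assoc[OF w assms(2,5)] by simp
    finally show ?thesis .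
  qed
  have "\<phi> \<cdot> prod_mor C s ?O = \<phi> \<cdot> prod_mor C t ?O"
    using *[OF c(1)] *[OF c(2)] c(3) by simp
  from coequaliser_factor[OF co prod_mor_hom[OF assms(2) ide_hom[OF assms(3)]] assms(4) this] that
  show thesis by blast
qed

text \<open>Write \<open>e \<times> e'\<close> as \<open>(e \<times> 1) (1 \<times> e')\<close> and descend in one variable at a time; the first axis
  is not affected by \<open>1 \<times> e'\<close>.\<close>

lemma factor_through_product:
  assumes e: "regular_epi C e" "e \<in> hom C X X'" and e': "regular_epi C e'" "e' \<in> hom C Y Y'"
    and \<phi>: "\<phi> \<in> hom C (X \<otimes> Y) Z"
    and a: "a \<in> hom C X' Z" "\<phi> \<cdot> axis1 X Y = a \<cdot> e"
    and b: "b \<in> hom C Y' Z" "\<phi> \<cdot> axis2 X Y = b \<cdot> e'"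
  obtains \<psi> where "\<psi> \<in> hom C (X' \<otimes> Y') Z" "\<psi> \<cdot> prod_mor C e e' = \<phi>"
proof -
  note X = hom_obj(1)[OF e(2)] and Y = hom_obj[OF e'(2)]
  note i = ide_hom[OF X] and i' = ide_hom[OF Y(2)]
  obtain \<chi> where \<chi>: "\<chi> \<in> hom C (X \<otimes> Y') Z" "\<chi> \<cdot> prod_mor C (Ide C X) e' = \<phi>"
    using factor_through_second[OF e' X \<phi> b] .
  have "\<chi> \<cdot> axis1 X Y' = \<chi> \<cdot> prod_mor C (Ide C X) e' \<cdot> axis1 X Y"
    using prod_mor_axis(1)[OF i e'(2)] comp_ide[OF axis_hom(1)[OF X Y(2)]] by simp
  also have "\<dots> = a \<cdot> e"
    using assoc[OF axis_hom(1)[OF X Y(1)] prod_mor_hom[OF i e'(2)] \<chi>(1)] \<chi>(2) a(2) by simp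
  finally obtain \<psi> where \<psi>: "\<psi> \<in> hom C (X' \<otimes> Y') Z" "\<psi> \<cdot> prod_mor C e (Ide C Y') = \<chi>"
    using factor_through_first[OF e Y(2) \<chi>(1) a(1)] by blast
  have "prod_mor C e e' = prod_mor C e (Ide C Y') \<cdot> prod_mor C (Ide C X) e'"
    using prod_mor_comp[OF i e'(2) e(2) i'] comp_ide[OF e(2)] ide_comp[OF e'(2)] by simp
  then have "\<psi> \<cdot> prod_mor C e e' = \<phi>"
    using assoc[OF prod_mor_hom[OF i e'(2)] prod_mor_hom[OF e(2) i'] \<psi>(1)] \<psi>(2) \<chi>(2) by simp
  then show thesis
    using that \<psi>(1) by blast
qed

text \<open>A morphism on \<open>X \<times> X\<close> whose two restrictions are \<open>e\<close> behaves like a multiplication on \<open>X\<close> with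
  values in the quotient \<open>Y\<close> of \<open>X\<close>; it descends to an actual multiplication on \<open>Y\<close>.\<close>

lemma commutative_object_quotient:
  assumes e: "regular_epi C e" "e \<in> hom C X Y"
    and \<phi>: "\<phi> \<in> hom C (X \<otimes> X) Y" "\<phi> \<cdot> axis1 X X = e" "\<phi> \<cdot> axis2 X X = e"
  shows "commutative_object C Y"
proof -
  note o = hom_obj[OF e(2)]
  note ee = prod_mor_hom[OF e(2,2)] and ax = axis_hom[OF o(1,1)] and ay = axis_hom[OF o(2,2)]
  obtain \<rho> where \<rho>: "\<rho> \<in> hom C (Y \<otimes> Y) Y" "\<rho> \<cdot> prod_mor C e e = \<phi>"
    using factor_through_product[OF e e \<phi>(1) ide_hom[OF o(2)] _ ide_hom[OF o(2)]] \<phi>(2,3)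
      ide_comp[OF e(2)] by metis
  have "(\<rho> \<cdot> axis1 Y Y) \<cdot> e = Ide C Y \<cdot> e"
    using assoc[OF e(2) ay(1) \<rho>(1)] prod_mor_axis(1)[OF e(2,2)] assoc[OF ax(1) ee \<rho>(1)] \<rho>(2) \<phi>(2)
      ide_comp[OF e(2)] by simp
  moreover have "(\<rho> \<cdot> axis2 Y Y) \<cdot> e = Ide C Y \<cdot> e"
    using assoc[OF e(2) ay(2) \<rho>(1)] prod_mor_axis(2)[OF e(2,2)] assoc[OF ax(2) ee \<rho>(1)] \<rho>(2) \<phi>(3)
      ide_comp[OF e(2)] by simp
  ultimately show ?thesis
    using regular_epi_cancel[OF e comp_hom[OF ay(1) \<rho>(1)] ide_hom[OF o(2)]]
      regular_epi_cancel[OF e comp_hom[OF ay(2) \<rho>(1)] ide_hom[OF o(2)]]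
      commutative_objectI[OF o(2) \<rho>(1)] by blast
qed

lemma commutative_object_regular_quotient:
  assumes e: "regular_epi C e" "e \<in> hom C X Y" and "commutative_object C X"
  shows "commutative_object C Y"
proof -
  obtain \<rho> where \<rho>: "X \<in> Obj C" "\<rho> \<in> hom C (X \<otimes> X) X"
    "\<rho> \<cdot> axis1 X X = Ide C X" "\<rho> \<cdot> axis2 X X = Ide C X"
    using commutative_objectE[OF assms(3)] .
  note ax = axis_hom[OF \<rho>(1,1)]
  show ?thesis
  proof (rule commutative_object_quotient[OF e comp_hom[OF \<rho>(2) e(2)]])
    show "(e \<cdot> \<rho>) \<cdot> axis1 X X = e"
      using assoc[OF ax(1) \<rho>(2) e(2)] \<rho>(3) comp_ide[OF e(2)] by simp
    show "(e \<cdot> \<rho>) \<cdot> axis2 X X = e"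
      using assoc[OF ax(2) \<rho>(2) e(2)] \<rho>(4) comp_ide[OF e(2)] by simp
  qed
qed

text \<open>The coequaliser of a pair in \<open>Com C\<close>, formed in \<open>C\<close>, already lies in \<open>Com C\<close>. So both
  coequalisers factor through each other, and the one in \<open>Com C\<close> inherits the universal property.\<close>

lemma inclusion_preserves_coequalisers: "preserves_coequalisers (Com C) C inclusion"
  unfolding preserves_coequalisers_def
proof (intro allI impI)
  fix u v q assume coD: "is_coequaliser (Com C) u v q"
  define X Y Q where "X = Dom C u" and "Y = Cod C u" and "Q = Cod C q"
  have D: "u \<in> hom (Com C) X Y" "v \<in> hom (Com C) X Y" "q \<in> hom (Com C) Y Q" "q \<cdot> u = q \<cdot> v"
    using coD unfolding is_coequaliser_def hom_def X_def Y_def Q_def by auto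
  have uniD: "\<exists>!g. g \<in> hom (Com C) Q Z \<and> g \<cdot> q = f"
    if "f \<in> hom (Com C) Y Z" "f \<cdot> u = f \<cdot> v" for Z f
    using coD that hom_dom_cod(2)[of q Y Q] D(3) unfolding is_coequaliser_def Q_def
    by (simp add: hom_Com)
  have c: "u \<in> hom C X Y" "v \<in> hom C X Y" "q \<in> hom C Y Q" "commutative_object C Y" "commutative_object C Q"
    using D by (auto simp: hom_Com)
  obtain q' where q': "is_coequaliser C u v q'"
    using coeqs c unfolding has_coequalisers_def by blast
  define Q' where "Q' = Cod C q'"
  have q'hom: "q' \<in> hom C Y Q'"
    using q' hom_dom_cod[OF c(1)] unfolding is_coequaliser_def hom_def Q'_def by auto
  have reg: "regular_epi C q'"
    using q' unfolding regular_epi_def by blast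
  have Q': "commutative_object C Q'"
    using commutative_object_regular_quotient[OF reg q'hom c(4)] .
  obtain h where h: "h \<in> hom C Q Q'" "h \<cdot> q = q'"
    using uniD[of q' Q'] coequaliser_hom(3)[OF q' q'hom] q'hom c(4) Q' by (auto simp: hom_Com)
  obtain k where k: "k \<in> hom C Q' Q" "k \<cdot> q' = q"
    using coequaliser_factor[OF q' q'hom c(3) D(4)] .
  have kh: "k \<cdot> h = Ide C Q"
  proof -
    have "(k \<cdot> h) \<cdot> q = q" "Ide C Q \<cdot> q = q"
      using assoc[OF c(3) h(1) k(1)] h(2) k(2) ide_comp[OF c(3)] by simp_all
    moreover have "k \<cdot> h \<in> hom (Com C) Q Q" "Ide C Q \<in> hom (Com C) Q Q"
      using comp_hom[OF h(1) k(1)] ide_hom[OF hom_obj(2)[OF c(3)]] c(5) by (auto simp: hom_Com)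
    ultimately show ?thesis
      using uniD[OF D(3,4)] by blast
  qed
  have "is_coequaliser C u v q"
  proof (rule coequaliserI[OF c(1-3) D(4)])
    fix Z f assume f: "f \<in> hom C Y Z" "f \<cdot> u = f \<cdot> v"
    obtain g where g: "g \<in> hom C Q' Z" "g \<cdot> q' = f"
      using coequaliser_factor[OF q' q'hom f] .
    have "(g \<cdot> h) \<cdot> q = f"
      using assoc[OF c(3) h(1) g(1)] h(2) g(2) by simp
    then show "\<exists>g\<in>hom C Q Z. g \<cdot> q = f"
      using comp_hom[OF h(1) g(1)] by blast
  next
    fix Z g g' assume g: "g \<in> hom C Q Z" "g' \<in> hom C Q Z" "g \<cdot> q = g' \<cdot> q"
    have "(g \<cdot> k) \<cdot> q' = (g' \<cdot> k) \<cdot> q'"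
      using assoc[OF q'hom k(1) g(1)] assoc[OF q'hom k(1) g(2)] k(2) g(3) by simp
    then have "g \<cdot> k = g' \<cdot> k"
      using regular_epi_cancel[OF reg q'hom comp_hom[OF k(1) g(1)] comp_hom[OF k(1) g(2)]] by blast
    then have "g \<cdot> k \<cdot> h = g' \<cdot> k \<cdot> h"
      using assoc[OF h(1) k(1) g(1)] assoc[OF h(1) k(1) g(2)] by simp
    then show "g = g'"
      using kh comp_ide[OF g(1)] comp_ide[OF g(2)] by simp
  qed
  then show "is_coequaliser C (on_arr inclusion u) (on_arr inclusion v) (on_arr inclusion q)"
    unfolding inclusion_def by simp
qed

end

section \<open>The reflection\<close>

locale pointed_category_T = pointed_category_products_coequalisers +
  assumes condT: "condition_T C"
begin

text \<open>The reflection arrow is the restriction \<open>q (1, 0) = q (0, 1)\<close> of the coequaliser \<open>q\<close> of the two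
  injections.\<close>

lemma ex_regular_commutative_reflection:
  assumes X: "X \<in> Obj C"
  obtains A e where "commutative_reflection X A e" "regular_epi C e"
proof -
  note ax = axis_hom[OF X X]
  obtain q where q: "is_coequaliser C (axis1 X X) (axis2 X X) q"
    using coeqs ax unfolding has_coequalisers_def by blast
  define A e where "A = Cod C q" and "e = q \<cdot> axis1 X X"
  have qhom: "q \<in> hom C (X \<otimes> X) A"
    using q hom_dom_cod[OF ax(1)] unfolding is_coequaliser_def hom_def A_def by auto
  have e: "e \<in> hom C X A" and e2: "q \<cdot> axis2 X X = e"
    using comp_hom[OF ax(1) qhom] coequaliser_hom(3)[OF q qhom] unfolding e_def by auto
  have "regular_epi C q"
    using q unfolding regular_epi_def by blast
  then have reg: "regular_epi C e"
    using condT X hom_obj(2)[OF qhom] qhom e e2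
    unfolding condition_T_def inj1_eq_axis1 inj2_eq_axis2 by (simp add: e_def)
  have "commutative_object C A"
    using commutative_object_quotient[OF reg e qhom _ e2] unfolding e_def by blast
  moreover have "\<exists>!g. g \<in> hom C A Z \<and> g \<cdot> e = f"
    if Z: "commutative_object C Z" and f: "f \<in> hom C X Z" for Z f
  proof -
    obtain \<rho> where \<rho>: "\<rho> \<in> hom C (Z \<otimes> Z) Z" "\<rho> \<cdot> axis1 Z Z = Ide C Z" "\<rho> \<cdot> axis2 Z Z = Ide C Z"
      using commutative_objectE[OF Z] by blast
    note m = mult_prod_mor_axis[OF \<rho> f]
    obtain g where g: "g \<in> hom C A Z" "g \<cdot> q = \<rho> \<cdot> prod_mor C f f"
      using coequaliser_factor[OF q qhom comp_hom[OF prod_mor_hom[OF f f] \<rho>(1)]] m by metis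
    have "g \<cdot> e = f"
      using assoc[OF ax(1) qhom g(1)] g(2) m(1) unfolding e_def by simp
    then show ?thesis
      using g(1) regular_epi_cancel[OF reg e] by blast
  qed
  ultimately have "commutative_reflection X A e"
    unfolding commutative_reflection_def using e by blast
  then show thesis
    using that reg by blast
qed

lemma commutative_reflection_regular_epi:
  assumes "commutative_reflection X A e"
  shows "regular_epi C e"
proof -
  obtain B e' where B: "commutative_reflection X B e'" "regular_epi C e'"
    using ex_regular_commutative_reflection[OF hom_obj(1)[OF commutative_reflectionD(1)[OF assms]]] .
  obtain h k where hk: "h \<in> hom C B A" "k \<in> hom C A B" "k \<cdot> h = Ide C B" "h \<cdot> k = Ide C A" "h \<cdot> e' = e"
    using commutative_reflection_iso[OF B(1) assms] .
  show ?thesis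
    using regular_epi_comp_iso[OF B(2) commutative_reflectionD(1)[OF B(1)] hk(1-4)] hk(5) by simp
qed

text \<open>The monomorphism factors through the reflection arrow of its domain, which is thus both
  monic and a regular epimorphism.\<close>

lemma commutative_object_subobject:
  assumes mono: "monomorphism C m" and m: "m \<in> hom C X Y" and Y: "commutative_object C Y"
  shows "commutative_object C X"
proof -
  obtain A e where A: "commutative_reflection X A e" "regular_epi C e"
    using ex_regular_commutative_reflection[OF hom_obj(1)[OF m]] .
  note e = commutative_reflectionD[OF A(1)]
  obtain g where g: "g \<in> hom C A Y" "g \<cdot> e = m"
    using e(3)[OF Y m] by blast
  have "f = f'" if f: "f \<in> hom C W X" "f' \<in> hom C W X" "e \<cdot> f = e \<cdot> f'" for W f f'
  proof -
    have "m \<cdot> f = m \<cdot> f'"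
      using assoc[OF f(1) e(1) g(1)] assoc[OF f(2) e(1) g(1)] f(3) g(2) by simp
    then show ?thesis
      using mono f(1,2) hom_dom_cod(2)[OF m] unfolding monomorphism_def by blast
  qed
  then obtain d where "d \<in> hom C A X" "d \<cdot> e = Ide C X" "e \<cdot> d = Ide C A"
    by (rule mono_regular_epi_iso[OF A(2) e(1)])
  then show ?thesis
    using commutative_object_retract[OF e(2,1)] by simp
qed

text \<open>For commutative \<open>Z\<close>, the restrictions of a morphism \<open>X \<times> Y \<rightarrow> Z\<close> to the axes factor through the
  reflection arrows of \<open>X\<close> and of \<open>Y\<close>.\<close>

lemma commutative_reflection_prod_mor:
  assumes X: "commutative_reflection X A e" and Y: "commutative_reflection Y B e'"
  shows "commutative_reflection (X \<otimes> Y) (A \<otimes> B) (prod_mor C e e')"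
proof -
  note A = commutative_reflectionD[OF X] and B = commutative_reflectionD[OF Y]
  note reg = commutative_reflection_regular_epi[OF X] commutative_reflection_regular_epi[OF Y]
  note ee = prod_mor_hom[OF A(1) B(1)]
  note ax = axis_hom[OF hom_obj(1)[OF A(1)] hom_obj(1)[OF B(1)]]
  have "\<exists>!g. g \<in> hom C (A \<otimes> B) Z \<and> g \<cdot> prod_mor C e e' = f"
    if Z: "commutative_object C Z" and f: "f \<in> hom C (X \<otimes> Y) Z" for Z f
  proof -
    obtain a where a: "a \<in> hom C A Z" "f \<cdot> axis1 X Y = a \<cdot> e"
      using A(3)[OF Z comp_hom[OF ax(1) f]] by metis
    obtain b where b: "b \<in> hom C B Z" "f \<cdot> axis2 X Y = b \<cdot> e'"
      using B(3)[OF Z comp_hom[OF ax(2) f]] by metis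
    obtain g where "g \<in> hom C (A \<otimes> B) Z" "g \<cdot> prod_mor C e e' = f"
      using factor_through_product[OF reg(1) A(1) reg(2) B(1) f a b] .
    then show ?thesis
      using regular_epi_cancel[OF regular_epi_prod_mor[OF reg] ee] by blast
  qed
  moreover have "commutative_object C (A \<otimes> B)"
    using commutative_object_binary_product[OF chosen_is_product A(2) B(2)]
      hom_obj(2)[OF A(1)] hom_obj(2)[OF B(1)] by blast
  ultimately show ?thesis
    unfolding commutative_reflection_def using ee by blast
qed

lemma reflection_preserves_binary_products:
  assumes "is_reflection C (Com C) r \<eta>"
  shows "preserves_binary_products C (Com C) r"
  unfolding preserves_binary_products_def
proof (intro allI impI)
  fix X Y P p q assume prod: "is_binary_product C X Y P p q"
  have o: "X \<in> Obj C" "Y \<in> Obj C" "P \<in> Obj C" and pq: "p \<in> hom C P X" "q \<in> hom C P Y"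
    using prod unfolding is_binary_product_def by auto
  let ?A = "on_obj r X" and ?B = "on_obj r Y" and ?R = "on_obj r P"
  let ?p = "on_arr r p" and ?q = "on_arr r q" and ?ee = "prod_mor C (\<eta> X) (\<eta> Y)"
  note refl = reflection_commutative_reflection[OF assms]
  note A = commutative_reflectionD[OF refl[OF o(1)]]
    and B = commutative_reflectionD[OF refl[OF o(2)]]
    and R = commutative_reflectionD[OF refl[OF o(3)]]
  note AB = commutative_reflectionD[OF commutative_reflection_prod_mor[OF refl[OF o(1)] refl[OF o(2)]]]
  note rh = reflection_arr_hom[OF assms pq(1)] reflection_arr_hom[OF assms pq(2)]
  note nat = reflection_natural[OF assms pq(1)] reflection_natural[OF assms pq(2)]
  let ?k = "pairing C p q" and ?m = "pairing C ?p ?q"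
  note k = pairing_hom[OF pq] and m = pairing_hom[OF rh]
  obtain j where j: "j \<in> hom C (X \<otimes> Y) P" "j \<cdot> ?k = Ide C P" "?k \<cdot> j = Ide C (X \<otimes> Y)"
    using binary_product_iso[OF prod] .
  \<comment> \<open>The comparison \<open>?m\<close> is compatible with the two reflection arrows of \<open>P \<cong> X \<otimes> Y\<close>, so its
    inverse is the morphism between reflections that is induced by \<open>j\<close>.\<close>
  have mk: "?m \<cdot> \<eta> P = ?ee \<cdot> ?k"
    using pairing_comp[OF rh R(1)] prod_mor_pairing[OF A(1) B(1) pq] nat by simp
  obtain \<psi> where \<psi>: "\<psi> \<in> hom C (?A \<otimes> ?B) ?R" "\<psi> \<cdot> ?ee = \<eta> P \<cdot> j"
    using AB(3)[OF R(2) comp_hom[OF j(1) R(1)]] by blast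
  have "(\<psi> \<cdot> ?m) \<cdot> \<eta> P = (\<psi> \<cdot> ?ee) \<cdot> ?k"
    using assoc[OF R(1) m \<psi>(1)] mk assoc[OF k AB(1) \<psi>(1)] by simp
  also have "\<dots> = \<eta> P"
    using \<psi>(2) assoc[OF k j(1) R(1)] j(2) comp_ide[OF R(1)] by simp
  finally have "\<psi> \<cdot> ?m = Ide C ?R"
    using R(3)[OF R(2,1)] comp_hom[OF m \<psi>(1)] ide_hom[OF hom_obj(2)[OF R(1)]] ide_comp[OF R(1)]
    by blast
  moreover have "(?m \<cdot> \<psi>) \<cdot> ?ee = (?m \<cdot> \<eta> P) \<cdot> j"
    using assoc[OF AB(1) \<psi>(1) m] \<psi>(2) assoc[OF j(1) R(1) m] by simp
  then have "(?m \<cdot> \<psi>) \<cdot> ?ee = ?ee"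
    using mk assoc[OF j(1) k AB(1)] j(3) comp_ide[OF AB(1)] by simp
  then have "?m \<cdot> \<psi> = Ide C (?A \<otimes> ?B)"
    using AB(3)[OF AB(2,1)] comp_hom[OF \<psi>(1) m] ide_hom[OF hom_obj(2)[OF AB(1)]] ide_comp[OF AB(1)]
    by blast
  ultimately have "is_binary_product C ?A ?B ?R ?p ?q"
    using binary_productI[OF hom_obj(2)[OF A(1)] hom_obj(2)[OF B(1)] rh \<psi>(1)] by blast
  then show "is_binary_product (Com C) ?A ?B ?R ?p ?q"
    using A(2) B(2) R(2) unfolding is_binary_product_def
    by (auto simp: Obj_Com hom_Com commutative_object_def)
qed

lemma birkhoff_Com: "birkhoff_subcategory TYPE('i) C (Com C)"
  unfolding birkhoff_subcategory_def
proof (intro conjI)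
  show "is_full_subcategory (Com C) C"
    unfolding is_full_subcategory_def Com_def by blast
  show "reflective C (Com C)"
    by (rule reflectiveI) (meson ex_regular_commutative_reflection)
  show "closed_under_binary_products C (Com C)"
    unfolding closed_under_binary_products_def Ball_def Obj_Com
    using commutative_object_binary_product by blast
  show "closed_under_products TYPE('i) C (Com C)"
    unfolding closed_under_products_def Ball_def Obj_Com
    using commutative_object_product by blast
  show "closed_under_subobjects C (Com C)"
    unfolding closed_under_subobjects_def Obj_Com
    using commutative_object_subobject[OF _ arr_hom] unfolding monomorphism_def by blast
  show "closed_under_regular_quotients C (Com C)"
    unfolding closed_under_regular_quotients_def Obj_Com
    using commutative_object_regular_quotient[OF _ arr_hom]
    unfolding regular_epi_def is_coequaliser_def by blast
qed

end

theorem proposition3p21: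
  fixes C :: "('o, 'm) cat"
  assumes "category C"
    and "pointed C"
    and "has_binary_products C"
    and "has_coequalisers C"
    and "products_commute_with_coequalisers C"
    and "condition_T C"
  shows "birkhoff_subcategory TYPE('i) C (Com C)
    \<and> (\<forall>r \<eta>. is_reflection C (Com C) r \<eta> \<longrightarrow> preserves_binary_products C (Com C) r)
    \<and> preserves_coequalisers (Com C) C inclusion"
proof -
  interpret pointed_category_T C
    by unfold_locales fact+
  show ?thesis
    using birkhoff_Com reflection_preserves_binary_products inclusion_preserves_coequalisers by blast
qed

end
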